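(* Every simple braid $\beta\in\mathcal{SB}=\coprod_{n\ge1}\mathcal{SB}_n$ is Markov equivalent to $1_m$, the unit braid in $\mathcal{MB}_m$, for some $m\ge1$.
   Context: $\mathcal{B}_n$ is Artin's braid group on $n$ strands, generated by $x_1,\dots,x_{n-1}$ with relations $x_ix_j=x_jx_i$ if $|i-j|\ge2$, $x_{i+1}x_ix_{i+1}=x_ix_{i+1}x_i$; $\mathcal{MB}_n\subset\mathcal{B}_n$ is the monoid of positive braids. A braid in $\mathcal{MB}_n$ is simple if it is represented by a word $x_{i_1}\cdots x_{i_k}$ with pairwise distinct indices; $\mathcal{SB}_n$ is the set of these, and in the disjoint union $\coprod_n\mathcal{SB}_n$ the number of strands is part of the data. Markov equivalence is the equivalence relation on $\coprod_n\mathcal{B}_n$ generated by the Markov moves: conjugation inside a fixed $\mathcal{B}_n$, and $\beta\leftrightarrow\beta x_n^{\pm1}$ for $\beta\in\mathcal{B}_n$, $\beta x_n^{\pm1}\in\mathcal{B}_{n+1}$. *)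

theory Defs
  imports "HOL-Algebra.Group"
begin

text \<open>Words in the letters \<open>x\<^sub>i\<close> and their formal inverses (\<open>1 \<le> i \<le> n - 1\<close>):
  \<open>(i, True)\<close> stands for \<open>x\<^sub>i\<close> and \<open>(i, False)\<close> for its inverse.\<close>

type_synonym braid_word = "(nat \<times> bool) list"

definition braid_words :: "nat \<Rightarrow> braid_word set" where
  "braid_words n = lists ({1..<n} \<times> UNIV)"

text \<open>The congruence on words given by Artin's presentation of the braid group on \<open>n\<close> strands;
  the rule \<open>cancel\<close> makes the quotient a group.\<close>

inductive braid_eq :: "nat \<Rightarrow> braid_word \<Rightarrow> braid_word \<Rightarrow> bool" for n :: nat where
  refl: "w \<in> braid_words n \<Longrightarrow> braid_eq n w w"
| sym: "braid_eq n v w \<Longrightarrow> braid_eq n w v"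
| trans: "braid_eq n u v \<Longrightarrow> braid_eq n v w \<Longrightarrow> braid_eq n u w"
| in_context: "braid_eq n v w \<Longrightarrow> a \<in> braid_words n \<Longrightarrow> b \<in> braid_words n \<Longrightarrow>
    braid_eq n (a @ v @ b) (a @ w @ b)"
| cancel: "i \<in> {1..<n} \<Longrightarrow> braid_eq n [(i, s), (i, \<not> s)] []"
| commute: "i \<in> {1..<n} \<Longrightarrow> j \<in> {1..<n} \<Longrightarrow> \<bar>int i - int j\<bar> \<ge> 2 \<Longrightarrow>
    braid_eq n [(i, True), (j, True)] [(j, True), (i, True)]"
| braid: "i \<in> {1..<n} \<Longrightarrow> i + 1 \<in> {1..<n} \<Longrightarrow>
    braid_eq n [(i + 1, True), (i, True), (i + 1, True)] [(i, True), (i + 1, True), (i, True)]"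

definition braid_rel :: "nat \<Rightarrow> braid_word rel" where
  "braid_rel n = {(v, w). braid_eq n v w}"

type_synonym braid = "braid_word set"

definition braid_group :: "nat \<Rightarrow> braid monoid" where
  "braid_group n = \<lparr>carrier = braid_words n // braid_rel n,
     mult = (\<lambda>A B. \<Union>a\<in>A. \<Union>b\<in>B. braid_rel n `` {a @ b}),
     one = braid_rel n `` {[]}\<rparr>"

definition braid_gen :: "nat \<Rightarrow> nat \<Rightarrow> braid" where
  "braid_gen n i = braid_rel n `` {[(i, True)]}"

definition positive_word_braid :: "nat \<Rightarrow> nat list \<Rightarrow> braid" where
  "positive_word_braid n is =
     foldr (\<lambda>i b. braid_gen n i \<otimes>\<^bsub>braid_group n\<^esub> b) is \<one>\<^bsub>braid_group n\<^esub>"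

definition positive_braids :: "nat \<Rightarrow> braid set" where
  "positive_braids n = positive_word_braid n ` lists {1..<n}"

definition simple_braids :: "nat \<Rightarrow> braid set" where
  "simple_braids n = {\<beta> \<in> positive_braids n.
     \<exists>is \<in> lists {1..<n}. distinct is \<and> \<beta> = positive_word_braid n is}"

text \<open>The homomorphism from \<open>n\<close> to \<open>n + 1\<close> strands sending \<open>x\<^sub>i\<close> to \<open>x\<^sub>i\<close>, which is implicit
  in regarding a braid on \<open>n\<close> strands as one on \<open>n + 1\<close> strands.\<close>

definition add_strand :: "nat \<Rightarrow> braid \<Rightarrow> braid" where
  "add_strand n \<beta> = (\<Union>w\<in>\<beta>. braid_rel (Suc n) `` {w})"

text \<open>Elements of the disjoint union of the braid groups are pairs (number of strands, braid).\<close>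

inductive markov_move :: "nat \<times> braid \<Rightarrow> nat \<times> braid \<Rightarrow> bool" where
  conjugation: "n \<ge> 1 \<Longrightarrow> \<beta> \<in> carrier (braid_group n) \<Longrightarrow> \<gamma> \<in> carrier (braid_group n) \<Longrightarrow>
    markov_move (n, \<beta>) (n, \<gamma> \<otimes>\<^bsub>braid_group n\<^esub> \<beta> \<otimes>\<^bsub>braid_group n\<^esub> inv\<^bsub>braid_group n\<^esub> \<gamma>)"
| pos_stabilization: "n \<ge> 1 \<Longrightarrow> \<beta> \<in> carrier (braid_group n) \<Longrightarrow>
    markov_move (n, \<beta>) (Suc n, add_strand n \<beta> \<otimes>\<^bsub>braid_group (Suc n)\<^esub> braid_gen (Suc n) n)"
| neg_stabilization: "n \<ge> 1 \<Longrightarrow> \<beta> \<in> carrier (braid_group n) \<Longrightarrow>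
    markov_move (n, \<beta>) (Suc n, add_strand n \<beta> \<otimes>\<^bsub>braid_group (Suc n)\<^esub>
      inv\<^bsub>braid_group (Suc n)\<^esub> braid_gen (Suc n) n)"

definition markov_equivalent :: "nat \<times> braid \<Rightarrow> nat \<times> braid \<Rightarrow> bool" where
  "markov_equivalent = equivclp markov_move"

definition all_simple_braids :: "(nat \<times> braid) set" where
  "all_simple_braids = (SIGMA n:{1..}. simple_braids n)"

lemma braid_words_simps [simp]:
  "[] \<in> braid_words n"
  "x # w \<in> braid_words n \<longleftrightarrow> fst x \<in> {1..<n} \<and> w \<in> braid_words n"
  "v @ w \<in> braid_words n \<longleftrightarrow> v \<in> braid_words n \<and> w \<in> braid_words n"
  by (cases x; auto simp: braid_words_def)+

lemma braid_eq_words: "braid_eq n v w \<Longrightarrow> v \<in> braid_words n \<and> w \<in> braid_words n"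
  by (induction rule: braid_eq.induct) auto

lemma equiv_braid_rel: "equiv (braid_words n) (braid_rel n)"
proof (rule equivI)
  show "braid_rel n \<subseteq> braid_words n \<times> braid_words n"
    by (auto simp: braid_rel_def dest: braid_eq_words)
  show "refl_on (braid_words n) (braid_rel n)"
    by (auto simp: refl_on_def braid_rel_def intro: braid_eq.refl)
  show "sym (braid_rel n)"
    unfolding braid_rel_def sym_def by (blast intro: braid_eq.sym)
  show "trans (braid_rel n)"
    unfolding braid_rel_def trans_def by (blast intro: braid_eq.trans)
qed

lemma braid_eq_append:
  assumes "braid_eq n v v'" "braid_eq n w w'"
  shows "braid_eq n (v @ w) (v' @ w')"
proof -
  have "braid_eq n ([] @ v @ w) ([] @ v' @ w)"
    using assms braid_eq_words by (intro braid_eq.in_context) auto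
  moreover have "braid_eq n (v' @ w @ []) (v' @ w' @ [])"
    using assms braid_eq_words by (intro braid_eq.in_context) auto
  ultimately show ?thesis by simp (rule braid_eq.trans)
qed

lemma braid_mult_class:
  assumes "v \<in> braid_words n" "w \<in> braid_words n"
  shows "(braid_rel n `` {v}) \<otimes>\<^bsub>braid_group n\<^esub> (braid_rel n `` {w}) = braid_rel n `` {v @ w}"
proof -
  have "congruent2 (braid_rel n) (braid_rel n) (\<lambda>a b. braid_rel n `` {a @ b})"
    by (intro congruent2I'; intro equiv_class_eq[OF equiv_braid_rel])
      (auto simp: braid_rel_def intro: braid_eq_append)
  then show ?thesis
    using UN_equiv_class2[OF equiv_braid_rel equiv_braid_rel _ assms]
    by (simp add: braid_group_def)
qed

lemma braid_class_closed:
  "w \<in> braid_words n \<Longrightarrow> braid_rel n `` {w} \<in> carrier (braid_group n)"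
  by (simp add: braid_group_def quotientI)

lemma braid_carrierE:
  assumes "\<beta> \<in> carrier (braid_group n)"
  obtains w where "w \<in> braid_words n" "\<beta> = braid_rel n `` {w}"
  using assms by (auto simp: braid_group_def elim: quotientE)

lemma braid_one: "\<one>\<^bsub>braid_group n\<^esub> = braid_rel n `` {[]}"
  by (simp add: braid_group_def)

lemma braid_word_inverse:
  assumes "w \<in> braid_words n"
  shows "braid_eq n (rev (map (\<lambda>(i, s). (i, \<not> s)) w) @ w) []"
    and "rev (map (\<lambda>(i, s). (i, \<not> s)) w) \<in> braid_words n"
proof -
  have "braid_eq n (rev (map (\<lambda>(i, s). (i, \<not> s)) w) @ w) [] \<and>
    rev (map (\<lambda>(i, s). (i, \<not> s)) w) \<in> braid_words n"
    using assms
  proof (induction w)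
    case Nil
    then show ?case by (auto intro: braid_eq.refl)
  next
    case (Cons x w)
    obtain i s where x: "x = (i, s)" by (cases x)
    let ?v = "rev (map (\<lambda>(i, s). (i, \<not> s)) w)"
    have v: "?v \<in> braid_words n" "w \<in> braid_words n" "i \<in> {1..<n}" "braid_eq n (?v @ w) []"
      using Cons x by auto
    have "braid_eq n [(i, \<not> s), (i, s)] []"
      using braid_eq.cancel[OF v(3), of "\<not> s"] by simp
    from braid_eq.in_context[OF this v(1,2)]
    have "braid_eq n (?v @ [(i, \<not> s), (i, s)] @ w) (?v @ w)" by simp
    then have "braid_eq n (?v @ [(i, \<not> s), (i, s)] @ w) []"
      using v(4) by (rule braid_eq.trans)
    with v show ?case by (simp add: x)
  qed
  then show "braid_eq n (rev (map (\<lambda>(i, s). (i, \<not> s)) w) @ w) []"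
    and "rev (map (\<lambda>(i, s). (i, \<not> s)) w) \<in> braid_words n" by auto
qed

lemma group_braid_group: "group (braid_group n)"
proof (rule groupI)
  fix \<beta> assume "\<beta> \<in> carrier (braid_group n)"
  then obtain w where w: "w \<in> braid_words n" "\<beta> = braid_rel n `` {w}"
    by (rule braid_carrierE)
  let ?v = "rev (map (\<lambda>(i, s). (i, \<not> s)) w)"
  have "braid_rel n `` {?v @ w} = braid_rel n `` {[]}"
    using braid_word_inverse[OF w(1)]
    by (intro equiv_class_eq[OF equiv_braid_rel]) (simp add: braid_rel_def)
  then show "\<exists>\<gamma>\<in>carrier (braid_group n). \<gamma> \<otimes>\<^bsub>braid_group n\<^esub> \<beta> = \<one>\<^bsub>braid_group n\<^esub>"
    using w braid_word_inverse(2)[OF w(1)]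
    by (intro bexI[of _ "braid_rel n `` {?v}"])
      (simp_all add: braid_mult_class braid_class_closed braid_one)
qed (auto elim!: braid_carrierE simp: braid_mult_class braid_class_closed braid_one)

lemma braid_words_Suc: "w \<in> braid_words n \<Longrightarrow> w \<in> braid_words (Suc n)"
  by (induction w) auto

lemma braid_eq_Suc: "braid_eq n v w \<Longrightarrow> braid_eq (Suc n) v w"
proof (induction rule: braid_eq.induct)
  case (refl w)
  then show ?case by (intro braid_eq.refl braid_words_Suc)
next
  case (sym v w)
  show ?case by (rule braid_eq.sym[OF sym.IH])
next
  case (trans u v w)
  show ?case by (rule braid_eq.trans[OF trans.IH])
next
  case (in_context v w a b)
  then show ?case by (intro braid_eq.in_context braid_words_Suc)
next
  case (cancel i s)
  then show ?case by (intro braid_eq.cancel) auto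
next
  case (commute i j)
  then show ?case by (intro braid_eq.commute) auto
next
  case (braid i)
  then show ?case by (intro braid_eq.braid) auto
qed

lemma add_strand_class:
  assumes "w \<in> braid_words n"
  shows "add_strand n (braid_rel n `` {w}) = braid_rel (Suc n) `` {w}"
proof -
  have "congruent (braid_rel n) (\<lambda>w. braid_rel (Suc n) `` {w})"
    by (intro congruentI equiv_class_eq[OF equiv_braid_rel])
      (auto simp: braid_rel_def intro: braid_eq_Suc)
  then show ?thesis
    unfolding add_strand_def by (rule UN_equiv_class[OF equiv_braid_rel _ assms])
qed

lemma inv_braid_gen:
  assumes "i \<in> {1..<n}"
  shows "inv\<^bsub>braid_group n\<^esub> braid_gen n i = braid_rel n `` {[(i, False)]}"
proof -
  interpret group "braid_group n" by (rule group_braid_group)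
  have "braid_rel n `` {[(i, False), (i, True)]} = braid_rel n `` {[]}"
    using braid_eq.cancel[OF assms, of False]
    by (intro equiv_class_eq[OF equiv_braid_rel]) (simp add: braid_rel_def)
  then show ?thesis
    using assms
    by (intro inv_equality) (simp_all add: braid_gen_def braid_mult_class braid_class_closed braid_one)
qed

lemma positive_word_braid_class:
  "is \<in> lists {1..<n} \<Longrightarrow>
    positive_word_braid n is = braid_rel n `` {map (\<lambda>i. (i, True)) is}"
proof (induction "is")
  case Nil
  then show ?case by (simp add: positive_word_braid_def braid_one)
next
  case (Cons i "is")
  have "map (\<lambda>i. (i, True)) is \<in> braid_words n"
    using Cons.prems by (auto simp: braid_words_def)
  with Cons show ?case
    by (simp add: positive_word_braid_def braid_gen_def braid_mult_class)
qed

end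

theory Submission imports Defs begin

text \<open>Let \<open>w\<close> be a word without repeated letters on \<open>n\<close> strands. If \<open>x\<^bsub>n-1\<^esub>\<close> occurs in \<open>w\<close>,
  then it occurs once, so a cyclic conjugation moves it to the end and a Markov move removes it
  together with a strand. Otherwise conjugation by \<open>x\<^sub>1 \<cdots> x\<^bsub>n-1\<^esub>\<close> raises every index by one,
  which can be repeated until \<open>x\<^bsub>n-1\<^esub>\<close> occurs.\<close>

abbreviation positive_word :: "nat list \<Rightarrow> braid_word" where
  "positive_word \<equiv> map (\<lambda>i. (i, True))"

lemma positive_word_in_braid_words [simp]:
  "positive_word is \<in> braid_words n \<longleftrightarrow> set is \<subseteq> {1..<n}"
  by (induction "is") auto

lemma braid_class_eq: "braid_eq n v w \<Longrightarrow> braid_rel n `` {v} = braid_rel n `` {w}"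
  by (intro equiv_class_eq[OF equiv_braid_rel]) (simp add: braid_rel_def)

declare braid_eq.trans [trans]

lemma markov_equivalent_sym: "markov_equivalent x y \<Longrightarrow> markov_equivalent y x"
  unfolding markov_equivalent_def by (rule equivclp_sym)

lemma markov_equivalent_trans [trans]:
  "markov_equivalent x y \<Longrightarrow> markov_equivalent y z \<Longrightarrow> markov_equivalent x z"
  unfolding markov_equivalent_def by (rule equivclp_trans)

text \<open>The hypothesis says \<open>u v = w u\<close> in the group, hence
  \<open>w = u v u^-1\<close>. Stating it without an inverse lets later steps work with positive
  words only.\<close>

lemma markov_equivalent_conjugate_words:
  assumes "n \<ge> 1" "u \<in> braid_words n" "v \<in> braid_words n" "w \<in> braid_words n"
    and "braid_eq n (u @ v) (w @ u)"
  shows "markov_equivalent (n, braid_rel n `` {v}) (n, braid_rel n `` {w})"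
proof -
  interpret group "braid_group n" by (rule group_braid_group)
  let ?c = "\<lambda>w. braid_rel n `` {w}"
  have mem: "?c u \<in> carrier (braid_group n)" "?c v \<in> carrier (braid_group n)"
    "?c w \<in> carrier (braid_group n)"
    using assms by (auto intro: braid_class_closed)
  have "?c u \<otimes>\<^bsub>braid_group n\<^esub> ?c v = ?c w \<otimes>\<^bsub>braid_group n\<^esub> ?c u"
    using assms by (simp add: braid_mult_class braid_class_eq)
  then have "?c u \<otimes>\<^bsub>braid_group n\<^esub> ?c v \<otimes>\<^bsub>braid_group n\<^esub> inv\<^bsub>braid_group n\<^esub> ?c u = ?c w"
    using mem by (simp add: m_assoc)
  then have "markov_move (n, ?c v) (n, ?c w)"
    using markov_move.conjugation[OF assms(1) mem(2,1)] by simp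
  then show ?thesis
    unfolding markov_equivalent_def by (rule r_into_equivclp)
qed

lemma markov_equivalent_stabilize_word:
  assumes "n \<ge> 1" "w \<in> braid_words n"
  shows "markov_equivalent (n, braid_rel n `` {w})
    (Suc n, braid_rel (Suc n) `` {w @ [(n, True)]})"
proof -
  have "add_strand n (braid_rel n `` {w}) \<otimes>\<^bsub>braid_group (Suc n)\<^esub> braid_gen (Suc n) n
      = braid_rel (Suc n) `` {w @ [(n, True)]}"
    using assms by (simp add: add_strand_class braid_gen_def braid_mult_class braid_words_Suc)
  then have "markov_move (n, braid_rel n `` {w})
      (Suc n, braid_rel (Suc n) `` {w @ [(n, True)]})"
    using markov_move.pos_stabilization[OF assms(1) braid_class_closed[OF assms(2)]] by simp
  then show ?thesis
    unfolding markov_equivalent_def by (rule r_into_equivclp)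
qed

lemma braid_eq_commute_word:
  assumes "i \<in> {1..<n}" "set js \<subseteq> {1..<n}" "\<forall>j\<in>set js. \<bar>int i - int j\<bar> \<ge> 2"
  shows "braid_eq n (positive_word (i # js)) (positive_word (js @ [i]))"
  using assms(2,3)
proof (induction js)
  case Nil
  then show ?case using assms(1) by (auto intro: braid_eq.refl)
next
  case (Cons j js)
  have "braid_eq n ([(i, True), (j, True)] @ positive_word js)
      ([(j, True), (i, True)] @ positive_word js)"
    using Cons.prems assms(1)
    by (intro braid_eq_append braid_eq.commute braid_eq.refl) auto
  moreover have "braid_eq n ([(j, True)] @ positive_word (i # js))
      ([(j, True)] @ positive_word (js @ [i]))"
    using Cons by (intro braid_eq_append braid_eq.refl) auto
  ultimately show ?case by (auto intro: braid_eq.trans)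
qed

text \<open>The trailing letter \<open>i\<close> travels left past every letter above
  \<open>Suc i\<close>, the braid relation turns \<open>i, Suc i, i\<close> into
  \<open>Suc i, i, Suc i\<close>, and the leading \<open>Suc i\<close> then travels left past every
  letter below \<open>i\<close>.\<close>

lemma braid_eq_shift_letter:
  assumes "i \<ge> 1" "Suc i < n"
  shows "braid_eq n (positive_word [1..<n] @ [(i, True)])
    ((Suc i, True) # positive_word [1..<n])"
proof -
  \<comment> \<open>All letters of \<open>q\<close> are at distance at least 2 from
    \<open>i\<close>, and all letters of \<open>p\<close> at distance at least 2 from
    \<open>Suc i\<close>, so only the middle pair needs the braid relation.\<close>
  define p q where "p = [1..<i]" and "q = [Suc (Suc i)..<n]"
  have split: "[1..<n] = p @ [i, Suc i] @ q"
  proof -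
    have "[1..<n] = [1..<i] @ [i..<n]"
      using assms upt_add_eq_append[of 1 i "n - i"] by simp
    then show ?thesis using assms by (simp add: p_def q_def upt_conv_Cons)
  qed
  have pq: "set p \<subseteq> {1..<n}" "set q \<subseteq> {1..<n}"
    using assms by (auto simp: p_def q_def)
  let ?w = positive_word
  have "braid_eq n (?w (p @ [i, Suc i]) @ ?w (q @ [i])) (?w (p @ [i, Suc i]) @ ?w (i # q))"
    using assms pq
    by (intro braid_eq_append braid_eq.sym[OF braid_eq_commute_word] braid_eq.refl)
      (auto simp: q_def)
  also have "braid_eq n (?w (p @ [i, Suc i]) @ ?w (i # q))
      (?w p @ ?w [Suc i, i, Suc i] @ ?w q)"
  proof -
    have "braid_eq n (?w p @ ?w [i, Suc i, i] @ ?w q) (?w p @ ?w [Suc i, i, Suc i] @ ?w q)"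
      using assms pq braid_eq.sym[OF braid_eq.braid[of i n]]
      by (intro braid_eq_append braid_eq.refl) auto
    then show ?thesis by simp
  qed
  also have "braid_eq n (?w p @ ?w [Suc i, i, Suc i] @ ?w q)
      (?w (Suc i # p) @ ?w ([i, Suc i] @ q))"
  proof -
    have "braid_eq n (?w (p @ [Suc i]) @ ?w ([i, Suc i] @ q))
        (?w (Suc i # p) @ ?w ([i, Suc i] @ q))"
      using assms pq
      by (intro braid_eq_append braid_eq.sym[OF braid_eq_commute_word] braid_eq.refl)
        (auto simp: p_def)
    then show ?thesis by simp
  qed
  finally show ?thesis unfolding split by simp
qed

text \<open>The full word passes over the letters one by one, raising each. The bound excludes the
  letter \<open>n - 1\<close>, whose successor is not a letter on \<open>n\<close> strands.\<close>

lemma braid_eq_shift_word: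
  assumes "set is \<subseteq> {1..<n - 1}"
  shows "braid_eq n (positive_word [1..<n] @ positive_word is)
    (positive_word (map Suc is) @ positive_word [1..<n])"
  using assms
proof (induction "is")
  case Nil
  then show ?case by (auto intro: braid_eq.refl)
next
  case (Cons i "is")
  have i: "i \<ge> 1" "Suc i < n" and "is": "set is \<subseteq> {1..<n}"
    using Cons.prems by fastforce+
  have "braid_eq n ((positive_word [1..<n] @ [(i, True)]) @ positive_word is)
      (((Suc i, True) # positive_word [1..<n]) @ positive_word is)"
    using "is" by (intro braid_eq_append braid_eq_shift_letter i braid_eq.refl) simp
  moreover have "braid_eq n ([(Suc i, True)] @ positive_word [1..<n] @ positive_word is)
      ([(Suc i, True)] @ positive_word (map Suc is) @ positive_word [1..<n])"
    using Cons i by (intro braid_eq_append[OF braid_eq.refl] Cons.IH) auto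
  ultimately show ?case by (auto intro: braid_eq.trans)
qed

text \<open>Stated for words, since distinctness, length and first letter belong to a chosen
  representative and not to its braid.\<close>

lemma markov_equivalent_distinct_word_one:
  assumes "n \<ge> 1" "set is \<subseteq> {1..<n}" "distinct is"
  shows "\<exists>m\<ge>1. markov_equivalent (n, braid_rel n `` {positive_word is})
    (m, \<one>\<^bsub>braid_group m\<^esub>)"
  using assms
\<comment> \<open>The order is lexicographic: removing a strand shortens the word, while a shift
  keeps the length and raises the first letter. The unspecified \<open>hd []\<close> is harmless, as
  the empty word is settled directly.\<close>
proof (induction "(n, is)" arbitrary: n "is"
    rule: wf_induct_rule[OF wf_measures[of "[\<lambda>(n, is). length is, \<lambda>(n, is). n - hd is]"],
      case_names less])
  case (less n "is")
  consider "is = []" | "is \<noteq> []" "n - 1 \<notin> set is" | "n - 1 \<in> set is" by blast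
  then show ?case
  proof cases
    case 1
    then show ?thesis
      using less.prems by (auto simp: braid_one markov_equivalent_def intro!: exI[of _ n])
  next
    case 2
    have bound: "i < n - 1" "1 \<le> i" if "i \<in> set is" for i
    proof -
      have "i < n" "i \<noteq> n - 1" "1 \<le> i" using that 2 less.prems by force+
      then show "i < n - 1" "1 \<le> i" by auto
    qed
    then have shift: "set is \<subseteq> {1..<n - 1}" "set (map Suc is) \<subseteq> {1..<n}" by fastforce+
    have "markov_equivalent (n, braid_rel n `` {positive_word is})
        (n, braid_rel n `` {positive_word (map Suc is)})"
      using less.prems shift
      by (intro markov_equivalent_conjugate_words[OF _ _ _ _ braid_eq_shift_word])
        (simp_all only: positive_word_in_braid_words set_upt)
    \<comment> \<open>The truncated difference drops strictly because
      \<open>hd is < n - 1\<close>.\<close>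
    moreover have "n - hd (map Suc is) < n - hd is"
      using 2 bound(1)[of "hd is"] by (simp add: hd_map)
    then have "\<exists>m\<ge>1. markov_equivalent (n, braid_rel n `` {positive_word (map Suc is)})
        (m, \<one>\<^bsub>braid_group m\<^esub>)"
      using less.prems shift by (intro less.hyps) (auto simp: distinct_map)
    ultimately show ?thesis by (blast intro: markov_equivalent_trans)
  next
    case 3
    then obtain a b where ab: "is = a @ (n - 1) # b" by (meson split_list)
    \<comment> \<open>As a letter, \<open>n - 1\<close> is at least 1, so a strand remains after one
      is removed.\<close>
    obtain k where k: "n = Suc k" "k \<ge> 1"
      using 3 less.prems by (cases n) auto
    \<comment> \<open>Distinctness keeps the letter \<open>k\<close> out of \<open>a\<close> and
      \<open>b\<close>, so \<open>b @ a\<close> is a word on \<open>k\<close> strands.\<close>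
    have sub: "set (b @ a) \<subseteq> {1..<k}"
    proof
      fix i assume "i \<in> set (b @ a)"
      then have "i \<in> {1..<n}" "i \<noteq> k" using less.prems ab k by auto
      then show "i \<in> {1..<k}" using k by auto
    qed
    \<comment> \<open>Both sides are the same list \<open>b @ a @ [k] @ b\<close>: conjugation by
      \<open>b\<close> is the cyclic rotation.\<close>
    have "braid_eq n (positive_word b @ positive_word is)
        (positive_word (b @ a @ [k]) @ positive_word b)"
      using less.prems ab k by (auto intro!: braid_eq.refl)
    then have "markov_equivalent (n, braid_rel n `` {positive_word is})
        (n, braid_rel n `` {positive_word (b @ a @ [k])})"
      using less.prems ab k by (intro markov_equivalent_conjugate_words) auto
    \<comment> \<open>Positive stabilization from \<open>k\<close> to \<open>n = Suc k\<close>
      strands, read backwards.\<close>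
    also have "markov_equivalent \<dots> (k, braid_rel k `` {positive_word (b @ a)})"
      using markov_equivalent_sym[OF markov_equivalent_stabilize_word[of k "positive_word (b @ a)"]]
        k sub by simp
    finally have step: "markov_equivalent (n, braid_rel n `` {positive_word is})
        (k, braid_rel k `` {positive_word (b @ a)})" .
    have "\<exists>m\<ge>1. markov_equivalent (k, braid_rel k `` {positive_word (b @ a)})
        (m, \<one>\<^bsub>braid_group m\<^esub>)"
      using less.prems ab k sub by (intro less.hyps) auto
    with step show ?thesis by (blast intro: markov_equivalent_trans)
  qed
qed

theorem corollary1p10:
  fixes \<beta> :: "nat \<times> braid"
  assumes "\<beta> \<in> all_simple_braids"
  shows "\<exists>m\<ge>1. markov_equivalent \<beta> (m, \<one>\<^bsub>braid_group m\<^esub>)"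
proof -
  obtain n "is" where "\<beta> = (n, positive_word_braid n is)" "n \<ge> 1"
      "is \<in> lists {1..<n}" "distinct is"
    using assms by (auto simp: all_simple_braids_def simple_braids_def)
  then show ?thesis
    using markov_equivalent_distinct_word_one[of n "is"]
    by (auto simp: positive_word_braid_class lists_eq_set)
qed

end
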